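(* Let $(\mathcal{F},\theta)$ be a pointed endofunctor on a category $\mathbb{C}$, and let $(\mathcal{E},\mathcal{M})$ be a prefactorization system on $\mathbb{C}$ such that, for every $C\in\mathbb{C}$, $\theta_C=\mu_C\circ\eta_C:C\rightarrow\mathcal{I}(C)\rightarrow\mathcal{F}(C)$ with $\eta_C\in\mathcal{E}$, $\mu_C\in\mathcal{M}$, and $\eta_C$ an epimorphism in $\mathbb{C}$. Let $(\mathcal{I},\eta)$ be the resulting pointed endofunctor. (1) If $\mathcal{F}$ is (the underlying functor of) a monad whose unit is $\theta:1_\mathbb{C}\rightarrow\mathcal{F}$, then $(\mathcal{I},\eta)$ is idempotent, i.e., $\eta\mathcal{I}$ is an isomorphism (and $(\mathcal{I},\eta)$ is well-pointed: $\mathcal{I}\eta=\eta\mathcal{I}$). (2) More specifically, if $\mathcal{F}=GF$, where $F:\mathbb{C}\rightarrow\mathbb{X}$ is left adjoint to $G:\mathbb{X}\rightarrow\mathbb{C}$ with unit $\theta:1_\mathbb{C}\rightarrow GF$, then there is a reflection $I:\mathbb{C}\rightarrow\mathbb{M}$, left adjoint to the full inclusion $H:\mathbb{M}\rightarrow\mathbb{C}$, where $\mathbb{M}=Fix(\mathcal{I},\eta)=Fix(HI,\eta)$. It also follows that $F\eta$ is an isomorphism. (3) $\mathbb{M}=Fix(\mathcal{I},\eta)$ is equal to $\mathcal{M}(F)$, the full replete subcategory of $\mathbb{C}$ determined by those objects $M$ such that $\theta_M:M\rightarrow\mathcal{F}(M)$ belongs to $\mathcal{M}$.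
   Context: A pointed endofunctor $(\mathcal{F},\theta)$ on $\mathbb{C}$ is a functor $\mathcal{F}:\mathbb{C}\rightarrow\mathbb{C}$ with a natural transformation $\theta:1_\mathbb{C}\rightarrow\mathcal{F}$. For morphisms $e,m$ write $e\downarrow m$ if for every commutative square $v\circ e=m\circ u$ there is a unique $w$ with $w\circ e=u$ and $m\circ w=v$. A prefactorization system $(\mathcal{E},\mathcal{M})$ is a pair of classes of morphisms with $\mathcal{E}=\{e\mid e\downarrow m \ \forall m\in\mathcal{M}\}$ and $\mathcal{M}=\{m\mid e\downarrow m\ \forall e\in\mathcal{E}\}$. The pointed endofunctor $(\mathcal{I},\eta)$ is given on objects by the chosen factorizations, and for $f:C\rightarrow C'$, $\mathcal{I}f$ is the unique morphism with $\mathcal{I}f\circ\eta_C=\eta_{C'}\circ f$ and $\mu_{C'}\circ\mathcal{I}f=\mathcal{F}f\circ\mu_C$. $Fix(\mathcal{I},\eta)$ is the full subcategory of $\mathbb{C}$ determined by the objects $M$ for which $\eta_M:M\rightarrow\mathcal{I}(M)$ is an isomorphism. In (2), $I$ is the corestriction of $\mathcal{I}$ to $\mathbb{M}$ (so $\mathcal{I}=HI$), and the unit of the reflection is $\eta$. *)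

theory Defs
  imports Main
begin

section \<open>Categories\<close>

record ('o, 'm) category_data =
  Obj :: "'o set"
  Arr :: "'m set"
  Dom :: "'m \<Rightarrow> 'o"
  Cod :: "'m \<Rightarrow> 'o"
  Ident :: "'o \<Rightarrow> 'm"
  Comp :: "'m \<Rightarrow> 'm \<Rightarrow> 'm"  (infixl \<open>\<cdot>\<index>\<close> 70)

text \<open>\<open>g \<cdot>\<^bsub>C\<^esub> f\<close> means \<open>g\<close> after \<open>f\<close>. Values outside \<^const>\<open>Obj\<close> and \<^const>\<open>Arr\<close>, and
  composites of non-composable arrows, are irrelevant.\<close>

definition hom :: "('o, 'm) category_data \<Rightarrow> 'o \<Rightarrow> 'o \<Rightarrow> 'm set" where
  "hom C a b = {f \<in> Arr C. Dom C f = a \<and> Cod C f = b}"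

locale category =
  fixes C :: "('o, 'm) category_data" (structure)
  assumes Dom_in_Obj: "f \<in> Arr C \<Longrightarrow> Dom C f \<in> Obj C"
    and Cod_in_Obj: "f \<in> Arr C \<Longrightarrow> Cod C f \<in> Obj C"
    and Ident_in_hom: "a \<in> Obj C \<Longrightarrow> Ident C a \<in> hom C a a"
    and Comp_in_hom: "\<lbrakk>f \<in> hom C a b; g \<in> hom C b c\<rbrakk> \<Longrightarrow> g \<cdot> f \<in> hom C a c"
    and Comp_Ident_right: "f \<in> hom C a b \<Longrightarrow> f \<cdot> Ident C a = f"
    and Comp_Ident_left: "f \<in> hom C a b \<Longrightarrow> Ident C b \<cdot> f = f"
    and Comp_assoc: "\<lbrakk>f \<in> hom C a b; g \<in> hom C b c; h \<in> hom C c d\<rbrakk>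
      \<Longrightarrow> h \<cdot> (g \<cdot> f) = (h \<cdot> g) \<cdot> f"

definition is_iso :: "('o, 'm) category_data \<Rightarrow> 'm \<Rightarrow> bool" where
  "is_iso C f \<longleftrightarrow> f \<in> Arr C \<and>
    (\<exists>g \<in> hom C (Cod C f) (Dom C f).
      g \<cdot>\<^bsub>C\<^esub> f = Ident C (Dom C f) \<and> f \<cdot>\<^bsub>C\<^esub> g = Ident C (Cod C f))"

definition is_epi :: "('o, 'm) category_data \<Rightarrow> 'm \<Rightarrow> bool" where
  "is_epi C f \<longleftrightarrow> f \<in> Arr C \<and>
    (\<forall>c. \<forall>g \<in> hom C (Cod C f) c. \<forall>h \<in> hom C (Cod C f) c.
      g \<cdot>\<^bsub>C\<^esub> f = h \<cdot>\<^bsub>C\<^esub> f \<longrightarrow> g = h)"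

definition full_subcategory :: "('o, 'm) category_data \<Rightarrow> 'o set \<Rightarrow> ('o, 'm) category_data" where
  "full_subcategory C S =
    C\<lparr>Obj := Obj C \<inter> S, Arr := {f \<in> Arr C. Dom C f \<in> S \<and> Cod C f \<in> S}\<rparr>"

definition replete :: "('o, 'm) category_data \<Rightarrow> ('o, 'm) category_data \<Rightarrow> bool" where
  "replete C D \<longleftrightarrow>
    (\<forall>f. is_iso C f \<and> Dom C f \<in> Obj D \<longrightarrow> Cod C f \<in> Obj D \<and> f \<in> Arr D)"


section \<open>Functors and natural transformations\<close>

record ('o, 'm, 'p, 'n) functor_data =
  omap :: "'o \<Rightarrow> 'p"
  amap :: "'m \<Rightarrow> 'n"

locale cat_functor = A: category A + B: category B
  for A :: "('o, 'm) category_data" and B :: "('p, 'n) category_data" +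
  fixes F :: "('o, 'm, 'p, 'n) functor_data"
  assumes omap_in_Obj: "a \<in> Obj A \<Longrightarrow> omap F a \<in> Obj B"
    and amap_in_hom: "f \<in> hom A a b \<Longrightarrow> amap F f \<in> hom B (omap F a) (omap F b)"
    and amap_Ident: "a \<in> Obj A \<Longrightarrow> amap F (Ident A a) = Ident B (omap F a)"
    and amap_Comp: "\<lbrakk>f \<in> hom A a b; g \<in> hom A b c\<rbrakk>
      \<Longrightarrow> amap F (g \<cdot>\<^bsub>A\<^esub> f) = amap F g \<cdot>\<^bsub>B\<^esub> amap F f"

text \<open>Equality of functors defined on \<open>A\<close>: the underlying HOL functions need only agree on \<open>A\<close>.\<close>

definition functor_eq ::
  "('o, 'm) category_data \<Rightarrow> ('o, 'm, 'p, 'n) functor_data \<Rightarrow> ('o, 'm, 'p, 'n) functor_data \<Rightarrow> bool"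
where
  "functor_eq A F G \<longleftrightarrow>
    (\<forall>a \<in> Obj A. omap F a = omap G a) \<and> (\<forall>f \<in> Arr A. amap F f = amap G f)"

definition id_functor :: "('o, 'm, 'o, 'm) functor_data" where
  "id_functor = \<lparr>omap = (\<lambda>a. a), amap = (\<lambda>f. f)\<rparr>"

text \<open>Functors do not record their domain and codomain, so the inclusion of any subcategory has the
  same underlying maps as the identity functor.\<close>

definition inclusion_functor :: "('o, 'm, 'o, 'm) functor_data" where
  "inclusion_functor = \<lparr>omap = (\<lambda>a. a), amap = (\<lambda>f. f)\<rparr>"

definition comp_functor ::
  "('p, 'n, 'q, 'r) functor_data \<Rightarrow> ('o, 'm, 'p, 'n) functor_data \<Rightarrow> ('o, 'm, 'q, 'r) functor_data"
  (infixl \<open>\<circ>\<^sub>F\<close> 70) where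
  "G \<circ>\<^sub>F F = \<lparr>omap = (\<lambda>a. omap G (omap F a)), amap = (\<lambda>f. amap G (amap F f))\<rparr>"

locale nat_trans = F: cat_functor A B F + G: cat_functor A B G
  for A :: "('o, 'm) category_data" and B :: "('p, 'n) category_data"
    and F G :: "('o, 'm, 'p, 'n) functor_data" +
  fixes \<tau> :: "'o \<Rightarrow> 'n"
  assumes component_in_hom: "a \<in> Obj A \<Longrightarrow> \<tau> a \<in> hom B (omap F a) (omap G a)"
    and naturality: "f \<in> hom A a b \<Longrightarrow> amap G f \<cdot>\<^bsub>B\<^esub> \<tau> a = \<tau> b \<cdot>\<^bsub>B\<^esub> amap F f"

locale nat_iso = nat_trans +
  assumes component_iso: "a \<in> Obj A \<Longrightarrow> is_iso B (\<tau> a)"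

definition nat_trans_functor ::
  "('p \<Rightarrow> 'n) \<Rightarrow> ('o, 'm, 'p, 'k) functor_data \<Rightarrow> 'o \<Rightarrow> 'n"  (infixl \<open>\<star>\<^sub>r\<close> 70) where
  "\<tau> \<star>\<^sub>r F = (\<lambda>a. \<tau> (omap F a))"

definition functor_nat_trans ::
  "('p, 'n, 'q, 'r) functor_data \<Rightarrow> ('o \<Rightarrow> 'n) \<Rightarrow> 'o \<Rightarrow> 'r"  (infixl \<open>\<star>\<^sub>l\<close> 70) where
  "G \<star>\<^sub>l \<tau> = (\<lambda>a. amap G (\<tau> a))"


section \<open>Adjunctions and monads\<close>

locale adjunction = F: cat_functor C X F + G: cat_functor X C G +
  unit: nat_trans C C id_functor "G \<circ>\<^sub>F F" \<eta> +
  counit: nat_trans X X "F \<circ>\<^sub>F G" id_functor \<epsilon>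
  for C :: "('o, 'm) category_data" and X :: "('p, 'n) category_data"
    and F :: "('o, 'm, 'p, 'n) functor_data" and G :: "('p, 'n, 'o, 'm) functor_data"
    and \<eta> :: "'o \<Rightarrow> 'm" and \<epsilon> :: "'p \<Rightarrow> 'n" +
  assumes triangle_F: "c \<in> Obj C \<Longrightarrow> \<epsilon> (omap F c) \<cdot>\<^bsub>X\<^esub> amap F (\<eta> c) = Ident X (omap F c)"
    and triangle_G: "x \<in> Obj X \<Longrightarrow> amap G (\<epsilon> x) \<cdot>\<^bsub>C\<^esub> \<eta> (omap G x) = Ident C (omap G x)"

definition left_adjoint_with_unit ::
  "('o, 'm) category_data \<Rightarrow> ('p, 'n) category_data \<Rightarrow> ('o, 'm, 'p, 'n) functor_data
    \<Rightarrow> ('p, 'n, 'o, 'm) functor_data \<Rightarrow> ('o \<Rightarrow> 'm) \<Rightarrow> bool" where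
  "left_adjoint_with_unit C X F G \<eta> \<longleftrightarrow> (\<exists>\<epsilon>. adjunction C X F G \<eta> \<epsilon>)"

locale monad = unit: nat_trans C C id_functor T \<eta> + mult: nat_trans C C "T \<circ>\<^sub>F T" T m
  for C :: "('o, 'm) category_data" and T :: "('o, 'm, 'o, 'm) functor_data"
    and \<eta> m :: "'o \<Rightarrow> 'm" +
  assumes mult_assoc: "c \<in> Obj C \<Longrightarrow> m c \<cdot>\<^bsub>C\<^esub> amap T (m c) = m c \<cdot>\<^bsub>C\<^esub> m (omap T c)"
    and mult_unit_left: "c \<in> Obj C \<Longrightarrow> m c \<cdot>\<^bsub>C\<^esub> \<eta> (omap T c) = Ident C (omap T c)"
    and mult_unit_right: "c \<in> Obj C \<Longrightarrow> m c \<cdot>\<^bsub>C\<^esub> amap T (\<eta> c) = Ident C (omap T c)"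


section \<open>Pointed endofunctors\<close>

locale pointed_endofunctor = nat_trans C C id_functor T \<tau>
  for C :: "('o, 'm) category_data" and T :: "('o, 'm, 'o, 'm) functor_data"
    and \<tau> :: "'o \<Rightarrow> 'm"

definition idempotent_pointed ::
  "('o, 'm) category_data \<Rightarrow> ('o, 'm, 'o, 'm) functor_data \<Rightarrow> ('o \<Rightarrow> 'm) \<Rightarrow> bool" where
  "idempotent_pointed C T \<tau> \<longleftrightarrow>
    pointed_endofunctor C T \<tau> \<and> nat_iso C C T (T \<circ>\<^sub>F T) (\<tau> \<star>\<^sub>r T)"

definition well_pointed ::
  "('o, 'm) category_data \<Rightarrow> ('o, 'm, 'o, 'm) functor_data \<Rightarrow> ('o \<Rightarrow> 'm) \<Rightarrow> bool" where
  "well_pointed C T \<tau> \<longleftrightarrow>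
    pointed_endofunctor C T \<tau> \<and> (\<forall>c \<in> Obj C. (T \<star>\<^sub>l \<tau>) c = (\<tau> \<star>\<^sub>r T) c)"

definition Fix ::
  "('o, 'm) category_data \<Rightarrow> ('o, 'm, 'o, 'm) functor_data \<Rightarrow> ('o \<Rightarrow> 'm)
    \<Rightarrow> ('o, 'm) category_data" where
  "Fix C T \<tau> = full_subcategory C {c \<in> Obj C. \<tau> c \<in> hom C c (omap T c) \<and> is_iso C (\<tau> c)}"

text \<open>The category \<open>\<M>(T)\<close> of a pointed endofunctor \<open>(T, \<theta>)\<close> depends only on the components of \<open>\<theta>\<close>.\<close>

definition pointed_in ::
  "('o, 'm) category_data \<Rightarrow> 'm set \<Rightarrow> ('o \<Rightarrow> 'm) \<Rightarrow> ('o, 'm) category_data" where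
  "pointed_in C \<M> \<theta> = full_subcategory C {c \<in> Obj C. \<theta> c \<in> \<M>}"


section \<open>Prefactorization systems\<close>

definition orthogonal :: "('o, 'm) category_data \<Rightarrow> 'm \<Rightarrow> 'm \<Rightarrow> bool" where
  "orthogonal C e m \<longleftrightarrow>
    (\<forall>u \<in> hom C (Dom C e) (Dom C m). \<forall>v \<in> hom C (Cod C e) (Cod C m).
      v \<cdot>\<^bsub>C\<^esub> e = m \<cdot>\<^bsub>C\<^esub> u \<longrightarrow>
      (\<exists>!w. w \<in> hom C (Cod C e) (Dom C m) \<and> w \<cdot>\<^bsub>C\<^esub> e = u \<and> m \<cdot>\<^bsub>C\<^esub> w = v))"

definition prefactorization_system ::
  "('o, 'm) category_data \<Rightarrow> 'm set \<Rightarrow> 'm set \<Rightarrow> bool" where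
  "prefactorization_system C \<E> \<M> \<longleftrightarrow>
    \<E> = {e \<in> Arr C. \<forall>m \<in> \<M>. orthogonal C e m} \<and>
    \<M> = {m \<in> Arr C. \<forall>e \<in> \<E>. orthogonal C e m}"

text \<open>Given chosen factorizations \<open>\<mu> c \<circ> \<eta> c : c \<rightarrow> J c \<rightarrow> T c\<close>, the arrow \<open>g : J c \<rightarrow> J c'\<close> making both
  squares over \<open>f : c \<rightarrow> c'\<close> commute.\<close>

definition induced_arrow ::
  "('o, 'm) category_data \<Rightarrow> ('o, 'm, 'o, 'm) functor_data \<Rightarrow> ('o \<Rightarrow> 'o) \<Rightarrow> ('o \<Rightarrow> 'm) \<Rightarrow> ('o \<Rightarrow> 'm)
    \<Rightarrow> 'm \<Rightarrow> 'm \<Rightarrow> bool" where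
  "induced_arrow C T J \<eta> \<mu> f g \<longleftrightarrow>
    g \<in> hom C (J (Dom C f)) (J (Cod C f)) \<and>
    g \<cdot>\<^bsub>C\<^esub> \<eta> (Dom C f) = \<eta> (Cod C f) \<cdot>\<^bsub>C\<^esub> f \<and>
    \<mu> (Cod C f) \<cdot>\<^bsub>C\<^esub> g = amap T f \<cdot>\<^bsub>C\<^esub> \<mu> (Dom C f)"

definition induced_functor ::
  "('o, 'm) category_data \<Rightarrow> ('o, 'm, 'o, 'm) functor_data \<Rightarrow> ('o \<Rightarrow> 'o) \<Rightarrow> ('o \<Rightarrow> 'm) \<Rightarrow> ('o \<Rightarrow> 'm)
    \<Rightarrow> ('o, 'm, 'o, 'm) functor_data" where
  "induced_functor C T J \<eta> \<mu> = \<lparr>omap = J, amap = (\<lambda>f. THE g. induced_arrow C T J \<eta> \<mu> f g)\<rparr>"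

end

theory Submission
  imports Defs
begin

text \<open>Two facts carry the proof. First, for an object \<open>c\<close> the arrow \<open>\<eta> c\<close> is invertible exactly when
  \<open>\<theta> c = \<mu> c \<cdot> \<eta> c\<close> lies in \<open>\<M>\<close> (\<open>\<eta>_iso_iff\<close>): the class \<open>\<M>\<close> contains the isomorphisms, is
  closed under composition, and \<open>m \<cdot> n \<in> \<M>\<close> with \<open>m \<in> \<M>\<close> forces \<open>n \<in> \<M>\<close>, while \<open>\<E> \<inter> \<M>\<close> consists of
  isomorphisms. This identifies the fixed objects. Second, \<open>\<theta> (J c) = T (\<eta> c) \<cdot> \<mu> c\<close> (\<open>\<theta>_J\<close>), because \<open>\<eta> c\<close> is an
  epimorphism and both sides agree after composition with it. Together they show that every \<open>J c\<close>
  is fixed as soon as \<open>T \<eta>\<close> is invertible (\<open>\<eta>_J_iso\<close>).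

  Invertibility of \<open>T \<eta>\<close> comes from the additional structure on \<open>T\<close>. If \<open>T\<close> is a monad with
  multiplication \<open>m\<close>, the inverse of \<open>T (\<eta> c)\<close> is \<open>m c \<cdot> T (\<mu> c)\<close>; that this is also a right inverse
  uses \<open>\<theta>_J\<close> once more. If \<open>T = G F\<close> for an adjunction with unit \<open>\<theta>\<close>, then already \<open>F (\<eta> c)\<close> is
  invertible: it is epimorphic because \<open>\<eta> c\<close> is, and split monomorphic because \<open>F (\<theta> c)\<close> is.

  Well-pointedness comes from naturality alone: the square of \<open>\<eta>\<close> at the arrow \<open>\<eta> c\<close> makes \<open>I (\<eta> c)\<close> and \<open>\<eta> (J c)\<close> agree
  after composition with the epimorphism \<open>\<eta> c\<close>. A well-pointed and idempotent \<open>(I, \<eta>)\<close> is the reflection onto its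
  fixed objects, with the inverses of \<open>\<eta>\<close> as counit.\<close>

section \<open>Isomorphisms and epimorphisms\<close>

context category
begin

lemma Comp_arr:
  assumes "f \<in> Arr C" "g \<in> Arr C" "Cod C f = Dom C g"
  shows "g \<cdot> f \<in> Arr C" "Dom C (g \<cdot> f) = Dom C f" "Cod C (g \<cdot> f) = Cod C g"
  using Comp_in_hom[of f "Dom C f" "Cod C f" g "Cod C g"] assms by (auto simp: hom_def)

lemma Ident_arr:
  assumes "a \<in> Obj C"
  shows "Ident C a \<in> Arr C" "Dom C (Ident C a) = a" "Cod C (Ident C a) = a"
  using Ident_in_hom[OF assms] by (auto simp: hom_def)

lemma Comp_assoc_arr:
  assumes "f \<in> Arr C" "g \<in> Arr C" "h \<in> Arr C" "Cod C f = Dom C g" "Cod C g = Dom C h"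
  shows "(h \<cdot> g) \<cdot> f = h \<cdot> (g \<cdot> f)"
  using Comp_assoc[of f "Dom C f" "Cod C f" g "Cod C g" h "Cod C h"] assms
  by (auto simp: hom_def)

lemma Comp_Ident_arr:
  assumes "f \<in> Arr C"
  shows "Dom C f = a \<Longrightarrow> f \<cdot> Ident C a = f" "Cod C f = b \<Longrightarrow> Ident C b \<cdot> f = f"
  using Comp_Ident_right[of f a "Cod C f"] Comp_Ident_left[of f "Dom C f" b] assms
  by (auto simp: hom_def)

text \<open>Used as rewrite rules, these compute domains and codomains and associate composites to the
  right.\<close>

lemmas arr_simps = hom_def Comp_arr Ident_arr Comp_assoc_arr Comp_Ident_arr Dom_in_Obj Cod_in_Obj

lemma hom_Obj: "f \<in> hom C a b \<Longrightarrow> a \<in> Obj C \<and> b \<in> Obj C"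
  by (auto simp: hom_def Dom_in_Obj Cod_in_Obj)

lemma is_isoI:
  assumes "f \<in> hom C a b" "g \<in> hom C b a" "g \<cdot> f = Ident C a" "f \<cdot> g = Ident C b"
  shows "is_iso C f"
  using assms by (auto simp: is_iso_def hom_def)

lemma is_isoE:
  assumes "is_iso C f" "f \<in> hom C a b"
  obtains g where "g \<in> hom C b a" "g \<cdot> f = Ident C a" "f \<cdot> g = Ident C b"
  using assms by (auto simp: is_iso_def hom_def)

lemma epi_cancel:
  assumes "is_epi C e" "e \<in> hom C a b" "g \<in> hom C b c" "h \<in> hom C b c" "g \<cdot> e = h \<cdot> e"
  shows "g = h"
  using assms by (auto simp: is_epi_def hom_def)

lemma split_mono_epi_iso:
  assumes f: "f \<in> hom C a b" and r: "r \<in> hom C b a" and "r \<cdot> f = Ident C a"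
    and epi: "is_epi C f"
  shows "is_iso C f"
proof (rule is_isoI[OF f r])
  have ob: "a \<in> Obj C" "b \<in> Obj C"
    using hom_Obj[OF f] by auto
  have "(f \<cdot> r) \<cdot> f = Ident C b \<cdot> f"
    using f r ob assms(3) by (simp add: arr_simps)
  then show "f \<cdot> r = Ident C b"
    by (rule epi_cancel[OF epi f Comp_in_hom[OF r f] Ident_in_hom[OF ob(2)]])
qed fact

end

context cat_functor
begin

lemma amap_iso:
  assumes "is_iso A f" "f \<in> hom A a b"
  shows "is_iso B (amap F f)"
proof -
  obtain g where g: "g \<in> hom A b a" "g \<cdot>\<^bsub>A\<^esub> f = Ident A a" "f \<cdot>\<^bsub>A\<^esub> g = Ident A b"
    using A.is_isoE[OF assms] .
  have ob: "a \<in> Obj A" "b \<in> Obj A"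
    using A.hom_Obj[OF assms(2)] by auto
  show ?thesis
  proof (rule B.is_isoI)
    show "amap F f \<in> hom B (omap F a) (omap F b)" "amap F g \<in> hom B (omap F b) (omap F a)"
      using assms(2) g(1) by (auto intro: amap_in_hom)
    show "amap F g \<cdot>\<^bsub>B\<^esub> amap F f = Ident B (omap F a)"
      using amap_Comp[OF assms(2) g(1)] amap_Ident ob g by simp
    show "amap F f \<cdot>\<^bsub>B\<^esub> amap F g = Ident B (omap F b)"
      using amap_Comp[OF g(1) assms(2)] amap_Ident ob g by simp
  qed
qed

end


section \<open>Orthogonality\<close>

context category
begin

lemma orthogonalI:
  assumes "e \<in> hom C a b" "m \<in> hom C c d"
    and "\<And>u v. \<lbrakk>u \<in> hom C a c; v \<in> hom C b d; v \<cdot> e = m \<cdot> u\<rbrakk>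
      \<Longrightarrow> \<exists>!w. w \<in> hom C b c \<and> w \<cdot> e = u \<and> m \<cdot> w = v"
  shows "orthogonal C e m"
  using assms by (auto simp: orthogonal_def hom_def)

lemma orthogonalD:
  assumes "orthogonal C e m" "e \<in> hom C a b" "m \<in> hom C c d"
    and "u \<in> hom C a c" "v \<in> hom C b d" "v \<cdot> e = m \<cdot> u"
  shows "\<exists>!w. w \<in> hom C b c \<and> w \<cdot> e = u \<and> m \<cdot> w = v"
  using assms unfolding orthogonal_def hom_def by auto

lemma orthogonal_iso:
  assumes e: "e \<in> hom C a b" and m: "m \<in> hom C c d" and iso: "is_iso C m"
  shows "orthogonal C e m"
proof (rule orthogonalI[OF e m])
  obtain i where i: "i \<in> hom C d c" "i \<cdot> m = Ident C c" "m \<cdot> i = Ident C d"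
    using is_isoE[OF iso m] .
  have ob: "a \<in> Obj C" "b \<in> Obj C" "c \<in> Obj C" "d \<in> Obj C"
    using hom_Obj[OF e] hom_Obj[OF m] by auto
  fix u v assume u: "u \<in> hom C a c" and v: "v \<in> hom C b d" and sq: "v \<cdot> e = m \<cdot> u"
  show "\<exists>!w. w \<in> hom C b c \<and> w \<cdot> e = u \<and> m \<cdot> w = v"
  proof (rule ex1I[of _ "i \<cdot> v"], intro conjI)
    show "i \<cdot> v \<in> hom C b c"
      using i v by (auto simp: arr_simps)
    have "(i \<cdot> v) \<cdot> e = i \<cdot> (m \<cdot> u)"
      using i v e sq by (simp add: arr_simps)
    also have "\<dots> = (i \<cdot> m) \<cdot> u"
      using i(1) m u by (simp add: arr_simps)
    finally show "(i \<cdot> v) \<cdot> e = u"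
      using i(2) u by (simp add: arr_simps)
    have "m \<cdot> (i \<cdot> v) = (m \<cdot> i) \<cdot> v"
      using i(1) m v by (simp add: arr_simps)
    then show "m \<cdot> (i \<cdot> v) = v"
      using i(3) v by (simp add: arr_simps)
  next
    fix w assume w: "w \<in> hom C b c \<and> w \<cdot> e = u \<and> m \<cdot> w = v"
    have "(i \<cdot> m) \<cdot> w = i \<cdot> v"
      using i(1) m w by (auto simp: arr_simps)
    then show "w = i \<cdot> v"
      using i(2) w by (simp add: arr_simps)
  qed
qed

lemma orthogonal_Comp:
  assumes e: "e \<in> hom C a b" and n: "n \<in> hom C x y" and m: "m \<in> hom C y z"
    and en: "orthogonal C e n" and em: "orthogonal C e m"
  shows "orthogonal C e (m \<cdot> n)"
proof (rule orthogonalI[OF e Comp_in_hom[OF n m]])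
  fix u v assume u: "u \<in> hom C a x" and v: "v \<in> hom C b z" and sq: "v \<cdot> e = (m \<cdot> n) \<cdot> u"
  have nu: "n \<cdot> u \<in> hom C a y" and sq': "v \<cdot> e = m \<cdot> (n \<cdot> u)"
    using sq n m u by (auto simp: arr_simps)
  note uniq1 = orthogonalD[OF em e m nu v sq']
  then obtain w1 where w1: "w1 \<in> hom C b y" "w1 \<cdot> e = n \<cdot> u" "m \<cdot> w1 = v"
    by blast
  note uniq2 = orthogonalD[OF en e n u w1(1,2)]
  then obtain w where w: "w \<in> hom C b x" "w \<cdot> e = u" "n \<cdot> w = w1"
    by blast
  show "\<exists>!w. w \<in> hom C b x \<and> w \<cdot> e = u \<and> (m \<cdot> n) \<cdot> w = v"
  proof (rule ex1I[of _ w])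
    show "w \<in> hom C b x \<and> w \<cdot> e = u \<and> (m \<cdot> n) \<cdot> w = v"
      using w w1 m n by (auto simp: arr_simps)
  next
    fix w' assume w': "w' \<in> hom C b x \<and> w' \<cdot> e = u \<and> (m \<cdot> n) \<cdot> w' = v"
    have "n \<cdot> w' \<in> hom C b y \<and> (n \<cdot> w') \<cdot> e = n \<cdot> u \<and> m \<cdot> (n \<cdot> w') = v"
      using w' m n e by (auto simp: arr_simps)
    then have "n \<cdot> w' = w1"
      using uniq1 w1 by blast
    then show "w' = w"
      using uniq2 w w' by blast
  qed
qed

text \<open>A diagonal for \<open>n\<close> is found by solving the square pasted with \<open>m\<close>; orthogonality to \<open>m\<close>
  alone then shows that it makes the lower triangle over \<open>n\<close> commute.\<close>

lemma orthogonal_cancel: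
  assumes e: "e \<in> hom C a b" and n: "n \<in> hom C x y" and m: "m \<in> hom C y z"
    and emn: "orthogonal C e (m \<cdot> n)" and em: "orthogonal C e m"
  shows "orthogonal C e n"
proof (rule orthogonalI[OF e n])
  fix u v assume u: "u \<in> hom C a x" and v: "v \<in> hom C b y" and sq: "v \<cdot> e = n \<cdot> u"
  have mv: "m \<cdot> v \<in> hom C b z" and nu: "n \<cdot> u \<in> hom C a y"
    using v m n u by (auto simp: arr_simps)
  have sq1: "(m \<cdot> v) \<cdot> e = (m \<cdot> n) \<cdot> u" and sq2: "(m \<cdot> v) \<cdot> e = m \<cdot> (n \<cdot> u)"
    using v m n u e sq by (auto simp: arr_simps)
  note uniq1 = orthogonalD[OF emn e Comp_in_hom[OF n m] u mv sq1]
  note uniq2 = orthogonalD[OF em e m nu mv sq2]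
  obtain w where w: "w \<in> hom C b x" "w \<cdot> e = u" "(m \<cdot> n) \<cdot> w = m \<cdot> v"
    using uniq1 by blast
  \<comment> \<open>Both \<open>n \<cdot> w\<close> and \<open>v\<close> are diagonals of the square with sides \<open>e\<close> and \<open>m\<close>.\<close>
  have "n \<cdot> w \<in> hom C b y \<and> (n \<cdot> w) \<cdot> e = n \<cdot> u \<and> m \<cdot> (n \<cdot> w) = m \<cdot> v"
    using w m n e by (auto simp: arr_simps)
  then have nw: "n \<cdot> w = v"
    using uniq2 v sq by blast
  show "\<exists>!w. w \<in> hom C b x \<and> w \<cdot> e = u \<and> n \<cdot> w = v"
  proof (rule ex1I[of _ w])
    show "w \<in> hom C b x \<and> w \<cdot> e = u \<and> n \<cdot> w = v"
      using w nw by blast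
  next
    fix w' assume w': "w' \<in> hom C b x \<and> w' \<cdot> e = u \<and> n \<cdot> w' = v"
    then have "(m \<cdot> n) \<cdot> w' = m \<cdot> v"
      using m n by (auto simp: arr_simps)
    then show "w' = w"
      using uniq1 w w' by blast
  qed
qed

text \<open>The diagonal of the square with identities as its two other sides is an inverse.\<close>

lemma orthogonal_self_iso:
  assumes e: "e \<in> hom C a b" and "orthogonal C e e"
  shows "is_iso C e"
proof -
  have ob: "a \<in> Obj C" "b \<in> Obj C"
    using hom_Obj[OF e] by auto
  have "Ident C b \<cdot> e = e \<cdot> Ident C a"
    using e ob by (simp add: arr_simps)
  then obtain w where "w \<in> hom C b a" "w \<cdot> e = Ident C a" "e \<cdot> w = Ident C b"
    using orthogonalD[OF assms(2) e e Ident_in_hom Ident_in_hom] ob by blast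
  then show ?thesis
    using is_isoI[OF e] by blast
qed

end

locale prefactorization = category C for C :: "('o, 'm) category_data" (structure) +
  fixes \<E> \<M> :: "'m set"
  assumes prefact: "prefactorization_system C \<E> \<M>"
begin

lemma mem_M_iff: "m \<in> \<M> \<longleftrightarrow> m \<in> Arr C \<and> (\<forall>e \<in> \<E>. orthogonal C e m)"
  using prefact unfolding prefactorization_system_def by blast

lemma E_arr: "e \<in> \<E> \<Longrightarrow> e \<in> hom C (Dom C e) (Cod C e)"
  using prefact unfolding prefactorization_system_def hom_def by blast

lemma iso_in_M: "is_iso C m \<Longrightarrow> m \<in> \<M>"
  using orthogonal_iso[OF E_arr] by (auto simp: mem_M_iff is_iso_def hom_def)

lemma M_Comp:
  assumes "n \<in> \<M>" "m \<in> \<M>" "n \<in> hom C a b" "m \<in> hom C b c"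
  shows "m \<cdot> n \<in> \<M>"
  using assms orthogonal_Comp[OF E_arr] Comp_in_hom[of n a b m c]
  by (auto simp: mem_M_iff hom_def)

lemma M_cancel:
  assumes "m \<cdot> n \<in> \<M>" "m \<in> \<M>" "n \<in> hom C a b" "m \<in> hom C b c"
  shows "n \<in> \<M>"
  using assms orthogonal_cancel[OF E_arr assms(3,4)] by (auto simp: mem_M_iff hom_def)

lemma E_M_iso: "e \<in> \<E> \<Longrightarrow> e \<in> \<M> \<Longrightarrow> is_iso C e"
  using orthogonal_self_iso[OF E_arr] by (auto simp: mem_M_iff)

end


section \<open>Functors, adjunctions and full subcategories\<close>

lemma (in category) cat_functor_id: "cat_functor C C id_functor"
  by unfold_locales (auto simp: id_functor_def)

lemma cat_functor_comp:
  assumes "cat_functor A B F" "cat_functor B D G"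
  shows "cat_functor A D (G \<circ>\<^sub>F F)"
proof -
  interpret F: cat_functor A B F
    by fact
  interpret G: cat_functor B D G
    by fact
  show ?thesis
    by unfold_locales
      (auto simp: comp_functor_def F.omap_in_Obj G.omap_in_Obj F.amap_Ident G.amap_Ident
        intro: F.amap_in_hom G.amap_in_hom
        simp: F.amap_Comp G.amap_Comp[OF F.amap_in_hom F.amap_in_hom])
qed

context adjunction
begin

lemma transpose_transpose:
  assumes g: "g \<in> hom X (omap F b) x" and b: "b \<in> Obj C"
  shows "\<epsilon> x \<cdot>\<^bsub>X\<^esub> amap F (amap G g \<cdot>\<^bsub>C\<^esub> \<eta> b) = g"
proof -
  have ob: "omap F b \<in> Obj X" "x \<in> Obj X"
    using F.B.hom_Obj[OF g] by auto
  have \<eta>: "\<eta> b \<in> hom C b (omap G (omap F b))"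
    using unit.component_in_hom[OF b] by (simp add: id_functor_def comp_functor_def)
  have Gg: "amap G g \<in> hom C (omap G (omap F b)) (omap G x)"
    using G.amap_in_hom[OF g] .
  have F\<eta>: "amap F (\<eta> b) \<in> hom X (omap F b) (omap F (omap G (omap F b)))"
    and FGg: "amap F (amap G g) \<in> hom X (omap F (omap G (omap F b))) (omap F (omap G x))"
    using F.amap_in_hom \<eta> Gg by auto
  have \<epsilon>: "\<epsilon> (omap F b) \<in> hom X (omap F (omap G (omap F b))) (omap F b)"
    "\<epsilon> x \<in> hom X (omap F (omap G x)) x"
    using counit.component_in_hom ob by (auto simp: id_functor_def comp_functor_def)
  have nat: "\<epsilon> x \<cdot>\<^bsub>X\<^esub> amap F (amap G g) = g \<cdot>\<^bsub>X\<^esub> \<epsilon> (omap F b)"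
    using counit.naturality[OF g] by (simp add: id_functor_def comp_functor_def)
  have "\<epsilon> x \<cdot>\<^bsub>X\<^esub> amap F (amap G g \<cdot>\<^bsub>C\<^esub> \<eta> b)
      = \<epsilon> x \<cdot>\<^bsub>X\<^esub> (amap F (amap G g) \<cdot>\<^bsub>X\<^esub> amap F (\<eta> b))"
    using F.amap_Comp[OF \<eta> Gg] by simp
  also have "\<dots> = (\<epsilon> x \<cdot>\<^bsub>X\<^esub> amap F (amap G g)) \<cdot>\<^bsub>X\<^esub> amap F (\<eta> b)"
    using F.B.Comp_assoc[OF F\<eta> FGg \<epsilon>(2)] .
  also have "\<dots> = g \<cdot>\<^bsub>X\<^esub> (\<epsilon> (omap F b) \<cdot>\<^bsub>X\<^esub> amap F (\<eta> b))"
    using F.B.Comp_assoc[OF F\<eta> \<epsilon>(1) g] nat by simp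
  also have "\<dots> = g"
    using triangle_F[OF b] F.B.Comp_Ident_right[OF g] by simp
  finally show ?thesis .
qed

text \<open>Precomposing with \<open>F e\<close> corresponds to precomposing the transpose with \<open>e\<close>, and transposition
  is injective.\<close>

lemma left_adjoint_preserves_epi:
  assumes epi: "is_epi C e" and e: "e \<in> hom C a b"
  shows "is_epi X (amap F e)"
proof -
  have ob: "a \<in> Obj C" "b \<in> Obj C"
    using F.A.hom_Obj[OF e] by auto
  have Fe: "amap F e \<in> hom X (omap F a) (omap F b)"
    using F.amap_in_hom[OF e] .
  have \<eta>: "\<eta> c \<in> hom C c (omap G (omap F c))" if "c \<in> Obj C" for c
    using unit.component_in_hom[OF that] by (simp add: id_functor_def comp_functor_def)
  have nat: "amap G (amap F e) \<cdot>\<^bsub>C\<^esub> \<eta> a = \<eta> b \<cdot>\<^bsub>C\<^esub> e"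
    using unit.naturality[OF e] by (simp add: id_functor_def comp_functor_def)
  have pre: "(amap G g \<cdot>\<^bsub>C\<^esub> \<eta> b) \<cdot>\<^bsub>C\<^esub> e = amap G (g \<cdot>\<^bsub>X\<^esub> amap F e) \<cdot>\<^bsub>C\<^esub> \<eta> a"
    if g: "g \<in> hom X (omap F b) x" for g x
    using F.A.Comp_assoc[OF e \<eta>[OF ob(2)] G.amap_in_hom[OF g]]
      F.A.Comp_assoc[OF \<eta>[OF ob(1)] G.amap_in_hom[OF Fe] G.amap_in_hom[OF g]]
      G.amap_Comp[OF Fe g] nat by simp
  have "g = h" if g: "g \<in> hom X (omap F b) x" and h: "h \<in> hom X (omap F b) x"
    and eq: "g \<cdot>\<^bsub>X\<^esub> amap F e = h \<cdot>\<^bsub>X\<^esub> amap F e" for g h x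
  proof -
    have "amap G g \<cdot>\<^bsub>C\<^esub> \<eta> b = amap G h \<cdot>\<^bsub>C\<^esub> \<eta> b"
    proof (rule F.A.epi_cancel[OF epi e])
      show "amap G g \<cdot>\<^bsub>C\<^esub> \<eta> b \<in> hom C b (omap G x)" "amap G h \<cdot>\<^bsub>C\<^esub> \<eta> b \<in> hom C b (omap G x)"
        using F.A.Comp_in_hom[OF \<eta>[OF ob(2)]] G.amap_in_hom g h by blast+
      show "(amap G g \<cdot>\<^bsub>C\<^esub> \<eta> b) \<cdot>\<^bsub>C\<^esub> e = (amap G h \<cdot>\<^bsub>C\<^esub> \<eta> b) \<cdot>\<^bsub>C\<^esub> e"
        by (simp only: pre[OF g] pre[OF h] eq)
    qed
    then show ?thesis
      using transpose_transpose[OF g ob(2)] transpose_transpose[OF h ob(2)] by metis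
  qed
  moreover have "amap F e \<in> Arr X" "Cod X (amap F e) = omap F b"
    using Fe by (simp_all add: hom_def)
  ultimately show ?thesis
    unfolding is_epi_def by metis
qed

end

lemma full_subcategory_simps:
  "Obj (full_subcategory C S) = Obj C \<inter> S"
  "Arr (full_subcategory C S) = {f \<in> Arr C. Dom C f \<in> S \<and> Cod C f \<in> S}"
  "Dom (full_subcategory C S) = Dom C" "Cod (full_subcategory C S) = Cod C"
  "Ident (full_subcategory C S) = Ident C" "Comp (full_subcategory C S) = Comp C"
  by (simp_all add: full_subcategory_def)

lemma hom_full_subcategory:
  "f \<in> hom (full_subcategory C S) a b \<longleftrightarrow> f \<in> hom C a b \<and> a \<in> S \<and> b \<in> S"
  by (auto simp: hom_def full_subcategory_simps)

lemma (in category) category_full_subcategory: "category (full_subcategory C S)"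
  by unfold_locales
    (auto simp: full_subcategory_simps hom_full_subcategory Ident_in_hom Comp_in_hom
      Comp_Ident_right Comp_Ident_left Comp_assoc Dom_in_Obj Cod_in_Obj)

lemma (in category) cat_functor_inclusion:
  "cat_functor (full_subcategory C S) C inclusion_functor"
proof -
  interpret S: category "full_subcategory C S"
    by (rule category_full_subcategory)
  show ?thesis
    by unfold_locales
      (auto simp: inclusion_functor_def full_subcategory_simps hom_full_subcategory)
qed

lemma (in cat_functor) cat_functor_corestrict:
  assumes "\<And>a. a \<in> Obj A \<Longrightarrow> omap F a \<in> S"
  shows "cat_functor A (full_subcategory B S) F"
proof -
  interpret S: category "full_subcategory B S"
    by (rule B.category_full_subcategory)
  show ?thesis
    by unfold_locales
      (auto simp: full_subcategory_simps hom_full_subcategory assms omap_in_Obj amap_Ident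
        dest: A.hom_Obj intro: amap_in_hom amap_Comp)
qed


section \<open>Factorized pointed endofunctors\<close>

locale factorized_pointed_endofunctor =
  prefactorization C \<E> \<M> + pointed_endofunctor C T \<theta>
  for C :: "('o, 'm) category_data" (structure) and \<E> \<M> :: "'m set"
    and T :: "('o, 'm, 'o, 'm) functor_data" and \<theta> :: "'o \<Rightarrow> 'm" +
  fixes J :: "'o \<Rightarrow> 'o" and \<eta> \<mu> :: "'o \<Rightarrow> 'm"
  assumes \<eta>_in_hom: "c \<in> Obj C \<Longrightarrow> \<eta> c \<in> hom C c (J c)"
    and \<mu>_in_hom: "c \<in> Obj C \<Longrightarrow> \<mu> c \<in> hom C (J c) (omap T c)"
    and factorization: "c \<in> Obj C \<Longrightarrow> \<theta> c = \<mu> c \<cdot> \<eta> c"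
    and \<eta>_in_E: "c \<in> Obj C \<Longrightarrow> \<eta> c \<in> \<E>"
    and \<mu>_in_M: "c \<in> Obj C \<Longrightarrow> \<mu> c \<in> \<M>"
    and \<eta>_epi: "c \<in> Obj C \<Longrightarrow> is_epi C (\<eta> c)"
begin

abbreviation I :: "('o, 'm, 'o, 'm) functor_data" where
  "I \<equiv> induced_functor C T J \<eta> \<mu>"

lemma omap_I: "omap I c = J c"
  by (simp add: induced_functor_def)

lemma J_Obj: "c \<in> Obj C \<Longrightarrow> J c \<in> Obj C"
  using \<eta>_in_hom hom_Obj by blast

lemma \<theta>_in_hom: "c \<in> Obj C \<Longrightarrow> \<theta> c \<in> hom C c (omap T c)"
  using component_in_hom by (simp add: id_functor_def)

lemma \<theta>_natural: "f \<in> hom C a b \<Longrightarrow> amap T f \<cdot> \<theta> a = \<theta> b \<cdot> f"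
  using naturality by (simp add: id_functor_def)

text \<open>The arrow is the diagonal of the square with \<open>\<eta> a \<in> \<E>\<close> on the left and \<open>\<mu> b \<in> \<M>\<close> on the right,
  which commutes by naturality of \<open>\<theta>\<close>.\<close>

lemma ex1_induced_arrow:
  assumes "f \<in> Arr C"
  shows "\<exists>!g. induced_arrow C T J \<eta> \<mu> f g"
proof -
  define a b where "a = Dom C f" and "b = Cod C f"
  have f: "f \<in> hom C a b" and ob: "a \<in> Obj C" "b \<in> Obj C"
    using assms by (auto simp: a_def b_def arr_simps)
  note [simp] = \<eta>_in_hom[OF ob(1)] \<eta>_in_hom[OF ob(2)] \<mu>_in_hom[OF ob(1)] \<mu>_in_hom[OF ob(2)]
  have Tf: "amap T f \<in> hom C (omap T a) (omap T b)"
    using G.amap_in_hom[OF f] .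
  have u: "\<eta> b \<cdot> f \<in> hom C a (J b)"
    using Comp_in_hom[OF f, of "\<eta> b"] by simp
  have v: "amap T f \<cdot> \<mu> a \<in> hom C (J a) (omap T b)"
    using Comp_in_hom[OF _ Tf, of "\<mu> a"] by simp
  have "(amap T f \<cdot> \<mu> a) \<cdot> \<eta> a = amap T f \<cdot> \<theta> a"
    using Comp_assoc[OF \<eta>_in_hom \<mu>_in_hom Tf] factorization ob(1) by simp
  also have "\<dots> = \<mu> b \<cdot> (\<eta> b \<cdot> f)"
    using \<theta>_natural[OF f] Comp_assoc[OF f \<eta>_in_hom \<mu>_in_hom] factorization ob(2) by simp
  finally have sq: "(amap T f \<cdot> \<mu> a) \<cdot> \<eta> a = \<mu> b \<cdot> (\<eta> b \<cdot> f)" .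
  have "orthogonal C (\<eta> a) (\<mu> b)"
    using \<eta>_in_E \<mu>_in_M ob mem_M_iff by blast
  from orthogonalD[OF this _ _ u v sq] show ?thesis
    by (simp add: induced_arrow_def a_def[symmetric] b_def[symmetric])
qed

lemma induced_arrow_amap:
  assumes "f \<in> hom C a b"
  shows "induced_arrow C T J \<eta> \<mu> f (amap I f)"
proof -
  have "f \<in> Arr C"
    using assms by (simp add: hom_def)
  then show ?thesis
    using theI'[OF ex1_induced_arrow] by (simp add: induced_functor_def)
qed

lemma amap_I_in_hom: "f \<in> hom C a b \<Longrightarrow> amap I f \<in> hom C (J a) (J b)"
  using induced_arrow_amap[of f a b] by (auto simp: induced_arrow_def hom_def)

lemma \<eta>_natural: "f \<in> hom C a b \<Longrightarrow> amap I f \<cdot> \<eta> a = \<eta> b \<cdot> f"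
  using induced_arrow_amap[of f a b] by (auto simp: induced_arrow_def hom_def)

text \<open>As \<open>\<eta>\<close> is epimorphic, naturality of \<open>\<eta>\<close> already determines the action of \<open>I\<close> on arrows;
  functoriality, among other things, follows from this.\<close>

lemma amap_I_unique:
  assumes f: "f \<in> hom C a b" and g: "g \<in> hom C (J a) (J b)" and "g \<cdot> \<eta> a = \<eta> b \<cdot> f"
  shows "amap I f = g"
proof -
  have "a \<in> Obj C"
    using hom_Obj[OF f] by simp
  moreover have "amap I f \<cdot> \<eta> a = g \<cdot> \<eta> a"
    using \<eta>_natural[OF f] assms(3) by simp
  ultimately show ?thesis
    using epi_cancel[OF \<eta>_epi \<eta>_in_hom amap_I_in_hom[OF f] g] by blast
qed

lemma cat_functor_I: "cat_functor C C I"
proof unfold_locales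
  fix a assume a: "a \<in> Obj C"
  then show "omap I a \<in> Obj C"
    by (simp add: omap_I J_Obj)
  show "amap I (Ident C a) = Ident C (omap I a)"
    using a amap_I_unique[OF Ident_in_hom[OF a] Ident_in_hom[OF J_Obj[OF a]]]
      Comp_Ident_left[OF \<eta>_in_hom[OF a]] Comp_Ident_right[OF \<eta>_in_hom[OF a]]
    by (simp add: omap_I)
next
  fix f a b assume "f \<in> hom C a b"
  then show "amap I f \<in> hom C (omap I a) (omap I b)"
    by (simp add: omap_I amap_I_in_hom)
next
  fix f a b g c assume f: "f \<in> hom C a b" and g: "g \<in> hom C b c"
  have ob: "a \<in> Obj C" "b \<in> Obj C" "c \<in> Obj C"
    using hom_Obj[OF f] hom_Obj[OF g] by auto
  note \<eta> = \<eta>_in_hom[OF ob(1)] \<eta>_in_hom[OF ob(2)] \<eta>_in_hom[OF ob(3)]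
  note If = amap_I_in_hom[OF f] and Ig = amap_I_in_hom[OF g]
  have "(amap I g \<cdot> amap I f) \<cdot> \<eta> a = amap I g \<cdot> (\<eta> b \<cdot> f)"
    using Comp_assoc[OF \<eta>(1) If Ig] \<eta>_natural[OF f] by simp
  also have "\<dots> = \<eta> c \<cdot> (g \<cdot> f)"
    using Comp_assoc[OF f \<eta>(2) Ig] Comp_assoc[OF f g \<eta>(3)] \<eta>_natural[OF g] by simp
  finally show "amap I (g \<cdot> f) = amap I g \<cdot> amap I f"
    using amap_I_unique[OF Comp_in_hom[OF f g] Comp_in_hom[OF If Ig]] by simp
qed

lemma pointed_endofunctor_I: "pointed_endofunctor C I \<eta>"
proof -
  interpret I: cat_functor C C I
    by (rule cat_functor_I)
  show ?thesis
    by unfold_locales (auto simp: id_functor_def omap_I \<eta>_in_hom \<eta>_natural)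
qed

lemma well_pointed_I: "well_pointed C I \<eta>"
  using pointed_endofunctor_I amap_I_unique[OF \<eta>_in_hom \<eta>_in_hom[OF J_Obj]]
  by (simp add: well_pointed_def functor_nat_trans_def nat_trans_functor_def omap_I)

text \<open>If \<open>\<theta> c = \<mu> c \<cdot> \<eta> c\<close> lies in \<open>\<M>\<close> then so does \<open>\<eta> c\<close>, by left cancellation of \<open>\<mu> c\<close>;
  an arrow of \<open>\<E>\<close> that lies in \<open>\<M>\<close> is invertible.\<close>

lemma \<eta>_iso_iff:
  assumes c: "c \<in> Obj C"
  shows "is_iso C (\<eta> c) \<longleftrightarrow> \<theta> c \<in> \<M>"
proof
  assume "is_iso C (\<eta> c)"
  then show "\<theta> c \<in> \<M>"
    using M_Comp[OF iso_in_M \<mu>_in_M \<eta>_in_hom \<mu>_in_hom] c factorization by simp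
next
  assume "\<theta> c \<in> \<M>"
  then have "\<eta> c \<in> \<M>"
    using M_cancel[OF _ \<mu>_in_M \<eta>_in_hom \<mu>_in_hom] c factorization by simp
  then show "is_iso C (\<eta> c)"
    using E_M_iso \<eta>_in_E c by blast
qed

lemma Fix_eq_pointed_in: "Fix C I \<eta> = pointed_in C \<M> \<theta>"
proof -
  have "{c \<in> Obj C. \<eta> c \<in> hom C c (omap I c) \<and> is_iso C (\<eta> c)} = {c \<in> Obj C. \<theta> c \<in> \<M>}"
    using \<eta>_iso_iff by (auto simp: omap_I \<eta>_in_hom)
  then show ?thesis
    by (simp add: Fix_def pointed_in_def)
qed

text \<open>Along an isomorphism \<open>f : a \<rightarrow> b\<close>, naturality gives \<open>\<theta> b = T f \<cdot> \<theta> a \<cdot> f\<^sup>-\<^sup>1\<close>.\<close>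

lemma replete_pointed_in: "replete C (pointed_in C \<M> \<theta>)"
  unfolding replete_def
proof (intro allI impI, elim conjE)
  fix f assume iso: "is_iso C f" and "Dom C f \<in> Obj (pointed_in C \<M> \<theta>)"
  define a b where "a = Dom C f" and "b = Cod C f"
  have f: "f \<in> hom C a b" and \<theta>a: "\<theta> a \<in> \<M>"
    using iso \<open>Dom C f \<in> _\<close>
    by (auto simp: a_def b_def is_iso_def hom_def pointed_in_def full_subcategory_simps)
  have ob: "a \<in> Obj C" "b \<in> Obj C"
    using hom_Obj[OF f] by auto
  obtain g where g: "g \<in> hom C b a" "g \<cdot> f = Ident C a" "f \<cdot> g = Ident C b"
    using is_isoE[OF iso f] .
  have g_iso: "is_iso C g"
    using is_isoI[OF g(1) f] g by simp
  note Tf = G.amap_in_hom[OF f]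
  have "amap T f \<cdot> \<theta> a \<in> \<M>"
    using M_Comp[OF \<theta>a iso_in_M[OF G.amap_iso[OF iso f]] \<theta>_in_hom[OF ob(1)] Tf] .
  moreover have "amap T f \<cdot> \<theta> a \<in> hom C a (omap T b)"
    using Comp_in_hom[OF \<theta>_in_hom[OF ob(1)] Tf] .
  ultimately have "(amap T f \<cdot> \<theta> a) \<cdot> g \<in> \<M>"
    using M_Comp[OF iso_in_M[OF g_iso] _ g(1)] by blast
  moreover have "(amap T f \<cdot> \<theta> a) \<cdot> g = \<theta> b"
    using Comp_assoc[OF g(1) f \<theta>_in_hom[OF ob(2)]] \<theta>_natural[OF f] g(3)
      Comp_Ident_right[OF \<theta>_in_hom[OF ob(2)]] by simp
  ultimately have "\<theta> b \<in> \<M>"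
    by simp
  then show "Cod C f \<in> Obj (pointed_in C \<M> \<theta>) \<and> f \<in> Arr (pointed_in C \<M> \<theta>)"
    using f ob \<theta>a by (auto simp: hom_def pointed_in_def full_subcategory_simps)
qed


section \<open>Idempotence\<close>

text \<open>Both sides agree after composition with the epimorphism \<open>\<eta> c\<close>, by naturality of \<open>\<theta>\<close>.\<close>

lemma \<theta>_J:
  assumes c: "c \<in> Obj C"
  shows "\<theta> (J c) = amap T (\<eta> c) \<cdot> \<mu> c"
proof -
  note \<eta> = \<eta>_in_hom[OF c] and \<mu> = \<mu>_in_hom[OF c] and J = J_Obj[OF c]
  note T\<eta> = G.amap_in_hom[OF \<eta>]
  have "\<theta> (J c) \<cdot> \<eta> c = (amap T (\<eta> c) \<cdot> \<mu> c) \<cdot> \<eta> c"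
    using \<theta>_natural[OF \<eta>] factorization[OF c] Comp_assoc[OF \<eta> \<mu> T\<eta>] by simp
  then show ?thesis
    by (rule epi_cancel[OF \<eta>_epi[OF c] \<eta> \<theta>_in_hom[OF J] Comp_in_hom[OF \<mu> T\<eta>]])
qed

text \<open>When \<open>T \<eta>\<close> is invertible, \<open>\<theta> (J c) = T (\<eta> c) \<cdot> \<mu> c\<close> is a composite of two arrows of \<open>\<M>\<close>, so
  \<open>J c\<close> is fixed.\<close>

lemma \<eta>_J_iso:
  assumes c: "c \<in> Obj C" and "is_iso C (amap T (\<eta> c))"
  shows "is_iso C (\<eta> (J c))"
proof -
  have "\<theta> (J c) \<in> \<M>"
    using M_Comp[OF \<mu>_in_M[OF c] iso_in_M[OF assms(2)] \<mu>_in_hom[OF c]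
        G.amap_in_hom[OF \<eta>_in_hom[OF c]]] \<theta>_J[OF c] by simp
  then show ?thesis
    using \<eta>_iso_iff[OF J_Obj[OF c]] by simp
qed

lemma idempotent_I:
  assumes "\<And>c. c \<in> Obj C \<Longrightarrow> is_iso C (amap T (\<eta> c))"
  shows "idempotent_pointed C I \<eta>"
proof -
  interpret I: cat_functor C C I
    by (rule cat_functor_I)
  interpret II: cat_functor C C "I \<circ>\<^sub>F I"
    using cat_functor_comp[OF cat_functor_I cat_functor_I] .
  have "nat_iso C C I (I \<circ>\<^sub>F I) (\<eta> \<star>\<^sub>r I)"
    by unfold_locales
      (auto simp: comp_functor_def nat_trans_functor_def omap_I J_Obj \<eta>_in_hom \<eta>_natural
        amap_I_in_hom \<eta>_J_iso assms)
  then show ?thesis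
    using pointed_endofunctor_I by (simp add: idempotent_pointed_def)
qed

text \<open>The inverse of \<open>T (\<eta> c)\<close> is \<open>m c \<cdot> T (\<mu> c)\<close>. One composite is \<open>m c \<cdot> T (\<theta> c)\<close>; the other is
  \<open>m (J c) \<cdot> T (T (\<eta> c) \<cdot> \<mu> c) = m (J c) \<cdot> T (\<theta> (J c))\<close>. Both are identities by a unit law.\<close>

lemma monad_T\<eta>_iso:
  assumes "monad C T \<theta> m" and c: "c \<in> Obj C"
  shows "is_iso C (amap T (\<eta> c))"
proof -
  interpret monad C T \<theta> m
    by fact
  note \<eta> = \<eta>_in_hom[OF c] and \<mu> = \<mu>_in_hom[OF c] and J = J_Obj[OF c]
  note T\<eta> = G.amap_in_hom[OF \<eta>] and T\<mu> = G.amap_in_hom[OF \<mu>]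
  note TT\<eta> = G.amap_in_hom[OF T\<eta>]
  have m: "m a \<in> hom C (omap T (omap T a)) (omap T a)" if "a \<in> Obj C" for a
    using mult.component_in_hom[OF that] by (simp add: comp_functor_def)
  show ?thesis
  proof (rule is_isoI[OF T\<eta> Comp_in_hom[OF T\<mu> m[OF c]]])
    show "(m c \<cdot> amap T (\<mu> c)) \<cdot> amap T (\<eta> c) = Ident C (omap T c)"
      using Comp_assoc[OF T\<eta> T\<mu> m[OF c]] G.amap_Comp[OF \<eta> \<mu>] factorization[OF c]
        mult_unit_right[OF c] by simp
    have "amap T (\<eta> c) \<cdot> (m c \<cdot> amap T (\<mu> c)) = (amap T (\<eta> c) \<cdot> m c) \<cdot> amap T (\<mu> c)"
      using Comp_assoc[OF T\<mu> m[OF c] T\<eta>] .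
    also have "\<dots> = (m (J c) \<cdot> amap T (amap T (\<eta> c))) \<cdot> amap T (\<mu> c)"
      using mult.naturality[OF \<eta>] by (simp add: comp_functor_def)
    also have "\<dots> = m (J c) \<cdot> amap T (\<theta> (J c))"
      using Comp_assoc[OF T\<mu> TT\<eta> m[OF J]] G.amap_Comp[OF \<mu> T\<eta>] \<theta>_J[OF c] by simp
    also have "\<dots> = Ident C (omap T (J c))"
      using mult_unit_right[OF J] .
    finally show "amap T (\<eta> c) \<cdot> (m c \<cdot> amap T (\<mu> c)) = Ident C (omap T (J c))" .
  qed
qed

text \<open>\<open>F (\<eta> c)\<close> is epimorphic, since left adjoints preserve epimorphisms, and it is a split
  monomorphism because \<open>F (\<theta> c) = F (\<mu> c) \<cdot> F (\<eta> c)\<close> is one by a triangle identity.\<close>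

lemma adjunction_F\<eta>_iso:
  assumes "adjunction C X F G \<theta> \<epsilon>" and T: "functor_eq C T (G \<circ>\<^sub>F F)" and c: "c \<in> Obj C"
  shows "is_iso X (amap F (\<eta> c))"
proof -
  interpret adj: adjunction C X F G \<theta> \<epsilon>
    by fact
  have "omap T c = omap G (omap F c)"
    using T c by (simp add: functor_eq_def comp_functor_def)
  then have \<mu>: "\<mu> c \<in> hom C (J c) (omap G (omap F c))"
    using \<mu>_in_hom[OF c] by simp
  note \<eta> = \<eta>_in_hom[OF c]
  note F\<eta> = adj.F.amap_in_hom[OF \<eta>] and F\<mu> = adj.F.amap_in_hom[OF \<mu>]
  have \<epsilon>: "\<epsilon> (omap F c) \<in> hom X (omap F (omap G (omap F c))) (omap F c)"
    using adj.counit.component_in_hom[OF adj.F.omap_in_Obj[OF c]]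
    by (simp add: id_functor_def comp_functor_def)
  have "(\<epsilon> (omap F c) \<cdot>\<^bsub>X\<^esub> amap F (\<mu> c)) \<cdot>\<^bsub>X\<^esub> amap F (\<eta> c) = Ident X (omap F c)"
    by (simp only: adj.F.B.Comp_assoc[OF F\<eta> F\<mu> \<epsilon>, symmetric]
        adj.F.amap_Comp[OF \<eta> \<mu>, symmetric] factorization[OF c, symmetric] adj.triangle_F[OF c])
  then show ?thesis
    by (rule adj.F.B.split_mono_epi_iso[OF F\<eta> adj.F.B.Comp_in_hom[OF F\<mu> \<epsilon>] _
          adj.left_adjoint_preserves_epi[OF \<eta>_epi[OF c] \<eta>]])
qed

lemma adjunction_nat_iso_F\<eta>:
  assumes "adjunction C X F G \<theta> \<epsilon>" and T: "functor_eq C T (G \<circ>\<^sub>F F)"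
  shows "nat_iso C X F (F \<circ>\<^sub>F I) (F \<star>\<^sub>l \<eta>)"
proof -
  interpret adj: adjunction C X F G \<theta> \<epsilon>
    by fact
  interpret FI: cat_functor C X "F \<circ>\<^sub>F I"
    using cat_functor_comp[OF cat_functor_I adj.F.cat_functor_axioms] .
  have nat: "amap F (amap I f) \<cdot>\<^bsub>X\<^esub> amap F (\<eta> a) = amap F (\<eta> b) \<cdot>\<^bsub>X\<^esub> amap F f"
    if f: "f \<in> hom C a b" for f a b
  proof -
    have ob: "a \<in> Obj C" "b \<in> Obj C"
      using hom_Obj[OF f] by auto
    show ?thesis
      using adj.F.amap_Comp[OF \<eta>_in_hom[OF ob(1)] amap_I_in_hom[OF f]]
        adj.F.amap_Comp[OF f \<eta>_in_hom[OF ob(2)]] \<eta>_natural[OF f] by simp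
  qed
  show ?thesis
  proof unfold_locales
    fix c assume c: "c \<in> Obj C"
    show "(F \<star>\<^sub>l \<eta>) c \<in> hom X (omap F c) (omap (F \<circ>\<^sub>F I) c)"
      using adj.F.amap_in_hom[OF \<eta>_in_hom[OF c]]
      by (simp add: comp_functor_def functor_nat_trans_def omap_I)
    show "is_iso X ((F \<star>\<^sub>l \<eta>) c)"
      using adjunction_F\<eta>_iso[OF assms c] by (simp add: functor_nat_trans_def)
  next
    fix f a b assume "f \<in> hom C a b"
    then show "amap (F \<circ>\<^sub>F I) f \<cdot>\<^bsub>X\<^esub> (F \<star>\<^sub>l \<eta>) a = (F \<star>\<^sub>l \<eta>) b \<cdot>\<^bsub>X\<^esub> amap F f"
      using nat by (simp add: comp_functor_def functor_nat_trans_def)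
  qed
qed


section \<open>The reflection onto the fixed objects\<close>

text \<open>The counit is the inverse of \<open>\<eta>\<close> on fixed objects. One triangle identity is its definition,
  the other one is well-pointedness.\<close>

lemma reflection:
  assumes J_iso: "\<And>c. c \<in> Obj C \<Longrightarrow> is_iso C (\<eta> (J c))"
  shows "left_adjoint_with_unit C (Fix C I \<eta>) I inclusion_functor \<eta>"
proof -
  define S where "S = {c \<in> Obj C. \<eta> c \<in> hom C c (omap I c) \<and> is_iso C (\<eta> c)}"
  define M where "M = full_subcategory C S"
  have M: "Fix C I \<eta> = M"
    by (simp add: Fix_def M_def S_def)
  have S_iff: "c \<in> S \<longleftrightarrow> c \<in> Obj C \<and> is_iso C (\<eta> c)" for c
    by (auto simp: S_def omap_I \<eta>_in_hom)
  have J_S: "J c \<in> S" if "c \<in> Obj C" for c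
    using that by (simp add: S_iff J_Obj J_iso)
  have ObjM: "c \<in> Obj M \<longleftrightarrow> c \<in> S" for c
    by (auto simp: M_def full_subcategory_simps S_iff)
  have homM: "f \<in> hom M a b \<longleftrightarrow> f \<in> hom C a b \<and> a \<in> S \<and> b \<in> S" for f a b
    by (simp add: M_def hom_full_subcategory)
  have MC: "Comp M = Comp C" "Ident M = Ident C"
    by (simp_all add: M_def full_subcategory_simps)
  interpret I: cat_functor C C I
    by (rule cat_functor_I)
  interpret I_M: cat_functor C M I
    unfolding M_def by (rule I.cat_functor_corestrict) (simp add: omap_I J_S)
  interpret H: cat_functor M C inclusion_functor
    unfolding M_def by (rule cat_functor_inclusion)
  interpret HI: cat_functor C C "inclusion_functor \<circ>\<^sub>F I"
    using cat_functor_comp[OF I_M.cat_functor_axioms H.cat_functor_axioms] .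
  interpret IH: cat_functor M M "I \<circ>\<^sub>F inclusion_functor"
    using cat_functor_comp[OF H.cat_functor_axioms I_M.cat_functor_axioms] .
  interpret id_M: cat_functor M M id_functor
    unfolding M_def by (rule category.cat_functor_id[OF category_full_subcategory])
  define \<epsilon> where "\<epsilon> c = (SOME g. g \<in> hom C (J c) c \<and> g \<cdot> \<eta> c = Ident C c \<and> \<eta> c \<cdot> g = Ident C (J c))"
    for c
  have "\<exists>g. g \<in> hom C (J c) c \<and> g \<cdot> \<eta> c = Ident C c \<and> \<eta> c \<cdot> g = Ident C (J c)" if "c \<in> S" for c
    using that is_isoE[OF _ \<eta>_in_hom] by (metis S_iff)
  from someI_ex[OF this]
  have \<epsilon>: "\<epsilon> c \<in> hom C (J c) c" "\<epsilon> c \<cdot> \<eta> c = Ident C c" "\<eta> c \<cdot> \<epsilon> c = Ident C (J c)"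
    if "c \<in> S" for c
    using that unfolding \<epsilon>_def by blast+
  have \<epsilon>_natural: "f \<cdot> \<epsilon> a = \<epsilon> b \<cdot> amap I f" if f: "f \<in> hom C a b" and ab: "a \<in> S" "b \<in> S" for f a b
  proof -
    have ob: "a \<in> Obj C" "b \<in> Obj C"
      using hom_Obj[OF f] by auto
    note \<eta>a = \<eta>_in_hom[OF ob(1)] and \<eta>b = \<eta>_in_hom[OF ob(2)]
    note If = amap_I_in_hom[OF f]
    have "(f \<cdot> \<epsilon> a) \<cdot> \<eta> a = f"
      using Comp_assoc[OF \<eta>a \<epsilon>(1)[OF ab(1)] f] \<epsilon>(2)[OF ab(1)] Comp_Ident_right[OF f] by simp
    also have "\<dots> = (\<epsilon> b \<cdot> amap I f) \<cdot> \<eta> a"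
      using Comp_assoc[OF \<eta>a If \<epsilon>(1)[OF ab(2)]] \<eta>_natural[OF f]
        Comp_assoc[OF f \<eta>b \<epsilon>(1)[OF ab(2)]] \<epsilon>(2)[OF ab(2)] Comp_Ident_left[OF f] by simp
    finally show ?thesis
      by (rule epi_cancel[OF \<eta>_epi[OF ob(1)] \<eta>a Comp_in_hom[OF \<epsilon>(1)[OF ab(1)] f]
            Comp_in_hom[OF If \<epsilon>(1)[OF ab(2)]]])
  qed
  have I\<eta>: "amap I (\<eta> c) = \<eta> (J c)" if "c \<in> Obj C" for c
    using well_pointed_I that
    by (simp add: well_pointed_def functor_nat_trans_def nat_trans_functor_def omap_I)
  have "adjunction C M I inclusion_functor \<eta> \<epsilon>"
  proof (unfold_locales, unfold id_functor_def inclusion_functor_def comp_functor_def omap_I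
      ObjM homM MC category_data.simps functor_data.simps)
    fix c assume c: "c \<in> Obj C"
    show "\<eta> c \<in> hom C c (J c)"
      using \<eta>_in_hom[OF c] .
    show "\<epsilon> (J c) \<cdot> amap I (\<eta> c) = Ident C (J c)"
      using I\<eta>[OF c] \<epsilon>(2)[OF J_S[OF c]] by simp
  next
    fix f a b assume "f \<in> hom C a b"
    then show "amap I f \<cdot> \<eta> a = \<eta> b \<cdot> f"
      by (rule \<eta>_natural)
  next
    fix c assume c: "c \<in> S"
    then have "c \<in> Obj C"
      by (simp add: S_iff)
    then show "\<epsilon> c \<in> hom C (J c) c \<and> J c \<in> S \<and> c \<in> S"
      using \<epsilon>(1)[OF c] J_S c by blast
    show "\<epsilon> c \<cdot> \<eta> c = Ident C c"
      using \<epsilon>(2)[OF c] .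
  next
    fix f a b assume "f \<in> hom C a b \<and> a \<in> S \<and> b \<in> S"
    then show "f \<cdot> \<epsilon> a = \<epsilon> b \<cdot> amap I f"
      using \<epsilon>_natural by blast
  qed
  then show ?thesis
    unfolding left_adjoint_with_unit_def M by blast
qed

end


section \<open>Fixed objects of a factorized monad or adjunction\<close>

theorem theorem2p1:
  fixes C :: "('o, 'm) category_data"
    and \<F> :: "('o, 'm, 'o, 'm) functor_data"
    and \<theta> \<eta> \<mu> :: "'o \<Rightarrow> 'm"
    and \<E> \<M> :: "'m set"
    and J :: "'o \<Rightarrow> 'o"
    and \<I> :: "('o, 'm, 'o, 'm) functor_data"
  assumes "pointed_endofunctor C \<F> \<theta>"
    and "prefactorization_system C \<E> \<M>"
    and "\<And>c. c \<in> Obj C \<Longrightarrow> \<eta> c \<in> hom C c (J c)"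
    and "\<And>c. c \<in> Obj C \<Longrightarrow> \<mu> c \<in> hom C (J c) (omap \<F> c)"
    and "\<And>c. c \<in> Obj C \<Longrightarrow> \<theta> c = \<mu> c \<cdot>\<^bsub>C\<^esub> \<eta> c"
    and "\<And>c. c \<in> Obj C \<Longrightarrow> \<eta> c \<in> \<E>"
    and "\<And>c. c \<in> Obj C \<Longrightarrow> \<mu> c \<in> \<M>"
    and "\<And>c. c \<in> Obj C \<Longrightarrow> is_epi C (\<eta> c)"
    and "\<I> = induced_functor C \<F> J \<eta> \<mu>"
  shows
    "((\<forall>f \<in> Arr C. \<exists>!g. induced_arrow C \<F> J \<eta> \<mu> f g) \<and> pointed_endofunctor C \<I> \<eta>) \<and>
     ((\<exists>m. monad C \<F> \<theta> m) \<longrightarrow> idempotent_pointed C \<I> \<eta> \<and> well_pointed C \<I> \<eta>) \<and>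
     (\<forall>(X :: ('p, 'n) category_data) F G.
        functor_eq C \<F> (G \<circ>\<^sub>F F) \<and> left_adjoint_with_unit C X F G \<theta> \<longrightarrow>
        (\<exists>I. functor_eq C \<I> (inclusion_functor \<circ>\<^sub>F I) \<and>
             left_adjoint_with_unit C (Fix C \<I> \<eta>) I inclusion_functor \<eta> \<and>
             Fix C \<I> \<eta> = Fix C (inclusion_functor \<circ>\<^sub>F I) \<eta>) \<and>
        nat_iso C X F (F \<circ>\<^sub>F \<I>) (F \<star>\<^sub>l \<eta>)) \<and>
     (Fix C \<I> \<eta> = pointed_in C \<M> \<theta> \<and> replete C (pointed_in C \<M> \<theta>))"
proof -
  interpret factorized_pointed_endofunctor C \<E> \<M> \<F> \<theta> J \<eta> \<mu>
  proof -
    interpret pointed_endofunctor C \<F> \<theta>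
      by fact
    show "factorized_pointed_endofunctor C \<E> \<M> \<F> \<theta> J \<eta> \<mu>"
      by unfold_locales (fact assms)+
  qed
  show ?thesis
    unfolding \<open>\<I> = _\<close>
  proof (intro conjI impI allI ballI; (elim exE conjE)?)
    fix m assume "monad C \<F> \<theta> m"
    then show "idempotent_pointed C I \<eta>"
      by (intro idempotent_I monad_T\<eta>_iso)
  next
    fix X :: "('p, 'n) category_data" and F G
    assume T: "functor_eq C \<F> (G \<circ>\<^sub>F F)" and "left_adjoint_with_unit C X F G \<theta>"
    then obtain \<epsilon> where adj: "adjunction C X F G \<theta> \<epsilon>"
      by (auto simp: left_adjoint_with_unit_def)
    show "nat_iso C X F (F \<circ>\<^sub>F I) (F \<star>\<^sub>l \<eta>)"
      using adjunction_nat_iso_F\<eta>[OF adj T] .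
    interpret adj: adjunction C X F G \<theta> \<epsilon>
      by (rule adj)
    have "is_iso C (\<eta> (J c))" if c: "c \<in> Obj C" for c
    proof (rule \<eta>_J_iso[OF c])
      (* Only the values of the functor on C matter here: it agrees with the composite on arrows
         of C without being equal to it. *)
      have "amap \<F> (\<eta> c) = amap G (amap F (\<eta> c))"
        using T \<eta>_in_hom[OF c] by (simp add: functor_eq_def comp_functor_def hom_def)
      then show "is_iso C (amap \<F> (\<eta> c))"
        using adj.G.amap_iso[OF adjunction_F\<eta>_iso[OF adj T c]
            adj.F.amap_in_hom[OF \<eta>_in_hom[OF c]]] by simp
    qed
    then have "left_adjoint_with_unit C (Fix C I \<eta>) I inclusion_functor \<eta>"
      by (rule reflection)
    moreover have "inclusion_functor \<circ>\<^sub>F I = I"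
      by (simp add: inclusion_functor_def comp_functor_def)
    ultimately show "\<exists>I'. functor_eq C I (inclusion_functor \<circ>\<^sub>F I') \<and>
        left_adjoint_with_unit C (Fix C I \<eta>) I' inclusion_functor \<eta> \<and>
        Fix C I \<eta> = Fix C (inclusion_functor \<circ>\<^sub>F I') \<eta>"
      by (intro exI[of _ I]) (simp add: functor_eq_def)
  qed (use ex1_induced_arrow pointed_endofunctor_I well_pointed_I Fix_eq_pointed_in
      replete_pointed_in in auto)
qed

end
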